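(* $A(n)$ is capable if and only if $n\geq 2$, where $A(n)$ denotes the abelian Lie algebra of dimension $n$.
   Context: All Lie algebras are finite dimensional. A Lie algebra $L$ is called capable if there exists a Lie algebra $E$ such that $L\cong E/Z(E)$, where $Z(E)$ is the center of $E$.
   Formalization: The formal statement assumes n ≥ 1: for n = 0 the zero Lie algebra A(0) is capable (it equals 0/Z(0)), so the equivalence with n ≥ 2 fails there. *)

theory Defs
  imports "Jordan_Normal_Form.Missing_VectorSpace" "HOL-Algebra.QuotRing"
begin

section \<open>Lie algebras\<close>

text \<open>
  As for vector spaces over \<^const>\<open>module\<close> records, the inherited ring fields \<^const>\<open>mult\<close> and
  \<^const>\<open>one\<close> of the record carry no meaning.
\<close>

record ('a, 'b) lie_alg = "('a, 'b) module" +
  bracket :: "'b \<Rightarrow> 'b \<Rightarrow> 'b" (\<open>(\<lblot>_,/ _\<rblot>\<index>)\<close>)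

text \<open>
  The bracket is alternating, not merely antisymmetric, so the definition is the usual one in
  characteristic 2 as well.
\<close>

locale lie_algebra = vectorspace K L
  for K :: "('a, 'k) ring_scheme" and L :: "('a, 'b, 'm) lie_alg_scheme" (structure) +
  assumes bracket_closed [simp, intro]:
      "\<lbrakk>x \<in> carrier L; y \<in> carrier L\<rbrakk> \<Longrightarrow> \<lblot>x, y\<rblot> \<in> carrier L"
    and bracket_add_left:
      "\<lbrakk>x \<in> carrier L; y \<in> carrier L; z \<in> carrier L\<rbrakk> \<Longrightarrow>
        \<lblot>x \<oplus>\<^bsub>L\<^esub> y, z\<rblot> = \<lblot>x, z\<rblot> \<oplus>\<^bsub>L\<^esub> \<lblot>y, z\<rblot>"
    and bracket_add_right:
      "\<lbrakk>x \<in> carrier L; y \<in> carrier L; z \<in> carrier L\<rbrakk> \<Longrightarrow>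
        \<lblot>x, y \<oplus>\<^bsub>L\<^esub> z\<rblot> = \<lblot>x, y\<rblot> \<oplus>\<^bsub>L\<^esub> \<lblot>x, z\<rblot>"
    and bracket_smult_left:
      "\<lbrakk>c \<in> carrier K; x \<in> carrier L; y \<in> carrier L\<rbrakk> \<Longrightarrow>
        \<lblot>c \<odot>\<^bsub>L\<^esub> x, y\<rblot> = c \<odot>\<^bsub>L\<^esub> \<lblot>x, y\<rblot>"
    and bracket_smult_right:
      "\<lbrakk>c \<in> carrier K; x \<in> carrier L; y \<in> carrier L\<rbrakk> \<Longrightarrow>
        \<lblot>x, c \<odot>\<^bsub>L\<^esub> y\<rblot> = c \<odot>\<^bsub>L\<^esub> \<lblot>x, y\<rblot>"
    and bracket_self: "x \<in> carrier L \<Longrightarrow> \<lblot>x, x\<rblot> = \<zero>\<^bsub>L\<^esub>"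
    and jacobi:
      "\<lbrakk>x \<in> carrier L; y \<in> carrier L; z \<in> carrier L\<rbrakk> \<Longrightarrow>
        \<lblot>x, \<lblot>y, z\<rblot>\<rblot> \<oplus>\<^bsub>L\<^esub> \<lblot>y, \<lblot>z, x\<rblot>\<rblot> \<oplus>\<^bsub>L\<^esub> \<lblot>z, \<lblot>x, y\<rblot>\<rblot> = \<zero>\<^bsub>L\<^esub>"

locale fin_dim_lie_algebra = lie_algebra +
  assumes fin_dim_L: "fin_dim"

definition abelian_lie :: "('a, 'b, 'm) lie_alg_scheme \<Rightarrow> bool"
  where "abelian_lie L \<longleftrightarrow> (\<forall>x \<in> carrier L. \<forall>y \<in> carrier L. \<lblot>x, y\<rblot>\<^bsub>L\<^esub> = \<zero>\<^bsub>L\<^esub>)"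

definition lie_center :: "('a, 'b, 'm) lie_alg_scheme \<Rightarrow> 'b set"
  where "lie_center L = {z \<in> carrier L. \<forall>x \<in> carrier L. \<lblot>z, x\<rblot>\<^bsub>L\<^esub> = \<zero>\<^bsub>L\<^esub>}"

text \<open>
  The quotient by an ideal \<open>I\<close>, modelled on \<^const>\<open>FactRing\<close>: its elements are the cosets of
  \<open>I\<close>, and the operations on cosets are the unions of the cosets of the results on
  representatives.
\<close>

definition lie_quotient :: "('a, 'b, 'm) lie_alg_scheme \<Rightarrow> 'b set \<Rightarrow> ('a, 'b set) lie_alg"
  where "lie_quotient L I =
    \<lparr>carrier = a_rcosets\<^bsub>L\<^esub> I, mult = undefined, one = undefined,
     zero = I, add = set_add L,
     smult = (\<lambda>c X. \<Union>x\<in>X. I +>\<^bsub>L\<^esub> (c \<odot>\<^bsub>L\<^esub> x)),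
     bracket = (\<lambda>X Y. \<Union>x\<in>X. \<Union>y\<in>Y. I +>\<^bsub>L\<^esub> \<lblot>x, y\<rblot>\<^bsub>L\<^esub>)\<rparr>"

definition lie_iso ::
    "('a, 'k) ring_scheme \<Rightarrow> ('a, 'b, 'm) lie_alg_scheme \<Rightarrow> ('a, 'c, 'n) lie_alg_scheme \<Rightarrow> ('b \<Rightarrow> 'c) set"
  where "lie_iso K L M = {f \<in> module_hom K L M. bij_betw f (carrier L) (carrier M) \<and>
    (\<forall>x \<in> carrier L. \<forall>y \<in> carrier L. f \<lblot>x, y\<rblot>\<^bsub>L\<^esub> = \<lblot>f x, f y\<rblot>\<^bsub>M\<^esub>)}"

definition lie_isomorphic ::
    "('a, 'k) ring_scheme \<Rightarrow> ('a, 'b, 'm) lie_alg_scheme \<Rightarrow> ('a, 'c, 'n) lie_alg_scheme \<Rightarrow> bool"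
  where "lie_isomorphic K L M \<longleftrightarrow> lie_iso K L M \<noteq> {}"

text \<open>
  HOL cannot quantify existentially over the type of elements of \<open>E\<close>, so \<open>E\<close> is taken with
  elements in \<^typ>\<open>nat \<Rightarrow> 'a\<close>, where \<^typ>\<open>'a\<close> is the type of scalars.  This is no restriction:
  every finite-dimensional space embeds there by coordinates, and \<open>capableI\<close> below shows
  that a witness \<open>E\<close> over any type makes \<open>L\<close> capable.
\<close>

definition capable :: "('a, 'k) ring_scheme \<Rightarrow> ('a, 'b, 'm) lie_alg_scheme \<Rightarrow> bool"
  where "capable K L \<longleftrightarrow>
    (\<exists>E :: ('a, nat \<Rightarrow> 'a) lie_alg. fin_dim_lie_algebra K E \<and>
      lie_isomorphic K L (lie_quotient E (lie_center E)))"


section \<open>Independence of the type of the covering algebra\<close>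

lemma (in vectorspace) fin_dim_embeds:
  assumes "fin_dim"
  shows "\<exists>\<phi> :: 'c \<Rightarrow> nat \<Rightarrow> 'a. inj_on \<phi> (carrier V)"
proof -
  obtain B where B: "finite B" "basis B"
    using finite_basis_exists[OF assms] by blast
  have BV: "B \<subseteq> carrier V" using B(2) by (simp add: basis_def)
  obtain co where co: "\<And>v. v \<in> carrier V \<Longrightarrow> co v \<in> B \<rightarrow>\<^sub>E carrier K \<and> lincomb (co v) B = v"
    using basis_criterion[OF B(1) BV] B(2) by metis
  obtain h where h: "bij_betw h {..<card B} B"
    using B(1) ex_bij_betw_nat_finite lessThan_atLeast0 by metis
  have "inj_on (\<lambda>v i. co v (h i)) (carrier V)"
  proof (rule inj_onI)
    fix v w assume v: "v \<in> carrier V" and w: "w \<in> carrier V"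
      and eq: "(\<lambda>i. co v (h i)) = (\<lambda>i. co w (h i))"
    have "co v b = co w b" if "b \<in> B" for b
      using h that eq by (metis bij_betw_imp_surj_on imageE)
    then have "co v = co w"
      using co[OF v] co[OF w] by (meson PiE_ext)
    then show "v = w" using co[OF v] co[OF w] by metis
  qed
  then show ?thesis by blast
qed

definition lie_transport :: "('b \<Rightarrow> 'c) \<Rightarrow> ('a, 'b, 'm) lie_alg_scheme \<Rightarrow> ('a, 'c) lie_alg"
  where "lie_transport f L = (let g = the_inv_into (carrier L) f in
    \<lparr>carrier = f ` carrier L, mult = undefined, one = undefined,
     zero = f \<zero>\<^bsub>L\<^esub>, add = (\<lambda>x y. f (g x \<oplus>\<^bsub>L\<^esub> g y)),
     smult = (\<lambda>c x. f (c \<odot>\<^bsub>L\<^esub> g x)),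
     bracket = (\<lambda>x y. f \<lblot>g x, g y\<rblot>\<^bsub>L\<^esub>)\<rparr>)"

context
  fixes f :: "'b \<Rightarrow> 'c" and L :: "('a, 'b, 'm) lie_alg_scheme"
  assumes inj: "inj_on f (carrier L)"
begin

lemma lie_transport_simps:
  "carrier (lie_transport f L) = f ` carrier L"
  "\<zero>\<^bsub>lie_transport f L\<^esub> = f \<zero>\<^bsub>L\<^esub>"
  "\<lbrakk>x \<in> carrier L; y \<in> carrier L\<rbrakk> \<Longrightarrow> f x \<oplus>\<^bsub>lie_transport f L\<^esub> f y = f (x \<oplus>\<^bsub>L\<^esub> y)"
  "x \<in> carrier L \<Longrightarrow> c \<odot>\<^bsub>lie_transport f L\<^esub> f x = f (c \<odot>\<^bsub>L\<^esub> x)"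
  "\<lbrakk>x \<in> carrier L; y \<in> carrier L\<rbrakk> \<Longrightarrow> \<lblot>f x, f y\<rblot>\<^bsub>lie_transport f L\<^esub> = f \<lblot>x, y\<rblot>\<^bsub>L\<^esub>"
  using inj by (simp_all add: lie_transport_def Let_def the_inv_into_f_f)

lemma lie_transport_vectorspace:
  assumes "vectorspace K L"
  shows "vectorspace K (lie_transport f L)"
proof -
  interpret vectorspace K L by fact
  show ?thesis
  proof (rule vs_criteria)
    show "field K" ..
    show "\<forall>v\<in>carrier (lie_transport f L). \<exists>neg_v\<in>carrier (lie_transport f L).
        v \<oplus>\<^bsub>lie_transport f L\<^esub> neg_v = \<zero>\<^bsub>lie_transport f L\<^esub>"
      by (auto simp: lie_transport_simps M.r_neg intro!: bexI[of _ "\<ominus>\<^bsub>L\<^esub> _"])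
  qed (auto simp: lie_transport_simps M.a_ac smult_assoc1 smult_l_distr smult_r_distr)
qed

lemma lie_transport_lie_algebra:
  assumes "lie_algebra K L"
  shows "lie_algebra K (lie_transport f L)"
proof -
  interpret lie_algebra K L by fact
  interpret T: vectorspace K "lie_transport f L"
    by (rule lie_transport_vectorspace) (rule vectorspace_axioms)
  show ?thesis
    by unfold_locales
      (auto simp: lie_transport_simps bracket_add_left bracket_add_right bracket_smult_left
        bracket_smult_right bracket_self jacobi)
qed

lemma lie_transport_fin_dim:
  assumes "fin_dim_lie_algebra K L"
  shows "fin_dim_lie_algebra K (lie_transport f L)"
proof -
  interpret fin_dim_lie_algebra K L by fact
  interpret T: lie_algebra K "lie_transport f L"
    by (rule lie_transport_lie_algebra) (rule lie_algebra_axioms)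
  have "f \<in> module_hom K L (lie_transport f L)"
    by (auto simp: module_hom_def lie_transport_simps)
  then interpret lm: linear_map K L "lie_transport f L" f
    by unfold_locales
  have "T.fin_dim"
    using lm.surj_fin_dim[OF fin_dim_L] by (simp add: lie_transport_simps)
  then show ?thesis
    by unfold_locales
qed

lemma lie_transport_center:
  assumes "lie_algebra K L"
  shows "lie_center (lie_transport f L) = f ` lie_center L"
proof -
  interpret lie_algebra K L by fact
  have "f \<lblot>x, y\<rblot>\<^bsub>L\<^esub> = f \<zero>\<^bsub>L\<^esub> \<longleftrightarrow> \<lblot>x, y\<rblot>\<^bsub>L\<^esub> = \<zero>\<^bsub>L\<^esub>"
    if "x \<in> carrier L" "y \<in> carrier L" for x y
    using inj that by (auto simp: inj_on_eq_iff)
  then show ?thesis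
    by (auto simp: lie_center_def lie_transport_simps)
qed

lemma lie_transport_coset:
  assumes "I \<subseteq> carrier L" "x \<in> carrier L"
  shows "f ` I +>\<^bsub>lie_transport f L\<^esub> f x = f ` (I +>\<^bsub>L\<^esub> x)"
  using assms by (force simp: a_r_coset_def' lie_transport_simps subset_iff)

lemma lie_transport_quotient:
  assumes "lie_algebra K L" and I: "I \<subseteq> carrier L"
  shows "(`) f \<in> lie_iso K (lie_quotient L I) (lie_quotient (lie_transport f L) (f ` I))"
proof -
  interpret lie_algebra K L by fact
  let ?T = "lie_transport f L"
  have sub: "X \<subseteq> carrier L" if "X \<in> a_rcosets\<^bsub>L\<^esub> I" for X
    using that I by (auto simp: A_RCOSETS_def' a_r_coset_def')
  have carr: "a_rcosets\<^bsub>?T\<^esub> (f ` I) = (`) f ` (a_rcosets\<^bsub>L\<^esub> I)"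
    using lie_transport_coset[OF I] by (auto simp: A_RCOSETS_def' lie_transport_simps)
  have "inj_on ((`) f) (a_rcosets\<^bsub>L\<^esub> I)"
    using inj_on_subset[OF inj_on_image_Pow[OF inj]] sub by blast
  then have bij: "bij_betw ((`) f) (a_rcosets\<^bsub>L\<^esub> I) (a_rcosets\<^bsub>?T\<^esub> (f ` I))"
    by (simp add: bij_betw_def carr)
  have add: "f ` (X <+>\<^bsub>L\<^esub> Y) = f ` X <+>\<^bsub>?T\<^esub> f ` Y"
    if "X \<subseteq> carrier L" "Y \<subseteq> carrier L" for X Y
    using that by (force simp: set_add_def' lie_transport_simps subset_iff)
  have smult: "f ` (\<Union>x\<in>X. I +>\<^bsub>L\<^esub> (c \<odot>\<^bsub>L\<^esub> x)) = (\<Union>x\<in>f ` X. f ` I +>\<^bsub>?T\<^esub> (c \<odot>\<^bsub>?T\<^esub> x))"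
    if "X \<subseteq> carrier L" "c \<in> carrier K" for X c
    unfolding image_UN UN_simps(10)
    using that I by (intro SUP_cong refl) (auto simp: lie_transport_simps lie_transport_coset subset_iff)
  have brack: "f ` (\<Union>x\<in>X. \<Union>y\<in>Y. I +>\<^bsub>L\<^esub> \<lblot>x, y\<rblot>\<^bsub>L\<^esub>) =
      (\<Union>x\<in>f ` X. \<Union>y\<in>f ` Y. f ` I +>\<^bsub>?T\<^esub> \<lblot>x, y\<rblot>\<^bsub>?T\<^esub>)"
    if "X \<subseteq> carrier L" "Y \<subseteq> carrier L" for X Y
    unfolding image_UN UN_simps(10)
    using that I by (intro SUP_cong refl) (auto simp: lie_transport_simps lie_transport_coset subset_iff)
  show ?thesis
    unfolding lie_iso_def module_hom_def lie_quotient_def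
    using bij by (auto simp: add smult brack sub carr)
qed

end

lemma lie_isomorphic_trans:
  assumes "lie_isomorphic K L M" "lie_isomorphic K M N"
  shows "lie_isomorphic K L N"
proof -
  obtain f g where f: "f \<in> lie_iso K L M" and g: "g \<in> lie_iso K M N"
    using assms by (auto simp: lie_isomorphic_def)
  then have "g \<circ> f \<in> lie_iso K L N"
    by (auto simp: lie_iso_def module_hom_def bij_betw_trans Pi_iff)
  then show ?thesis by (auto simp: lie_isomorphic_def)
qed

theorem capableI:
  fixes E :: "('a, 'e, 'n) lie_alg_scheme"
  assumes E: "fin_dim_lie_algebra K E"
    and iso: "lie_isomorphic K L (lie_quotient E (lie_center E))"
  shows "capable K L"
proof -
  interpret E: fin_dim_lie_algebra K E by fact
  obtain \<phi> :: "'e \<Rightarrow> nat \<Rightarrow> 'a" where \<phi>: "inj_on \<phi> (carrier E)"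
    using E.fin_dim_embeds[OF E.fin_dim_L] by blast
  let ?E = "lie_transport \<phi> E"
  have "lie_isomorphic K (lie_quotient E (lie_center E)) (lie_quotient ?E (lie_center ?E))"
    using lie_transport_quotient[OF \<phi> E.lie_algebra_axioms, of "lie_center E"]
      lie_transport_center[OF \<phi> E.lie_algebra_axioms]
    by (auto simp: lie_isomorphic_def lie_center_def[of E])
  then show ?thesis
    unfolding capable_def
    using lie_transport_fin_dim[OF \<phi> E] lie_isomorphic_trans[OF iso] by blast
qed

end

theory Submission
  imports Defs
begin

text \<open>
  If \<open>E/Z(E)\<close> is spanned by the coset of a single \<open>x\<close>, then every element of \<open>E\<close> has the form
  \<open>z + c x\<close> with \<open>z\<close> central, so \<open>E\<close> is abelian and \<open>E/Z(E)\<close> is zero.  Hence a one-dimensional Lie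
  algebra is never capable (\<open>central_mod_cyclic_imp_abelian\<close>, \<open>not_capable_dim_1\<close>).

  For the converse, let \<open>\<phi>\<close> be a nonzero linear functional on a space \<open>A\<close> of dimension at least two.
  On \<open>A \<times> A\<close> the bracket \<open>[(a, c), (b, d)] = (0, \<phi>(a) b - \<phi>(b) a)\<close> takes values in \<open>0 \<times> A\<close> and
  vanishes as soon as one argument lies there, which makes the Jacobi identity trivial.  The
  subspace \<open>0 \<times> A\<close> is the whole center: if \<open>\<phi>(a) b = \<phi>(b) a\<close> for all \<open>b\<close>, then a nonzero \<open>b\<close> in the
  kernel of \<open>\<phi>\<close> gives \<open>\<phi>(a) = 0\<close>, and a \<open>b\<close> with \<open>\<phi>(b) = 1\<close> then gives \<open>a = 0\<close>
  (\<open>functional_extension_center\<close>).  So the quotient by the center is the abelian Lie algebra on \<open>A\<close>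
  (\<open>functional_extension_central_quotient\<close>).  Both \<open>\<phi>\<close> and the nonzero vector in its kernel come
  from a basis with at least two elements.  The argument works over every field, since no
  division by an integer occurs.
\<close>

section \<open>Linear algebra\<close>

text \<open>
  The preimage of a subspace \<open>U\<close> is a subspace, so it contains the span of \<open>S\<close> once it contains \<open>S\<close>.
\<close>

lemma (in linear_map) image_span_subset:
  assumes "S \<subseteq> carrier V" "T ` S \<subseteq> U" "submodule K U W" "v \<in> V.module.span S"
  shows "T v \<in> U"
proof -
  have "submodule K {v \<in> carrier V. T v \<in> U} V"
    by unfold_locales (use assms(3) in \<open>auto simp: submodule_def\<close>)
  then have "V.module.span S \<subseteq> {v \<in> carrier V. T v \<in> U}"
    by (rule V.module.span_is_subset[rotated]) (use assms in auto)
  then show ?thesis using assms(4) by blast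
qed

lemma fin_dim_sum_of_images:
  assumes "linear_map K V1 W S" "linear_map K V2 W T"
    and "vectorspace.fin_dim K V1" "vectorspace.fin_dim K V2"
    and surj: "\<And>w. w \<in> carrier W \<Longrightarrow> \<exists>x \<in> carrier V1. \<exists>y \<in> carrier V2. w = S x \<oplus>\<^bsub>W\<^esub> T y"
  shows "vectorspace.fin_dim K W"
proof -
  interpret V1: vectorspace K V1 using assms(1) by (simp add: linear_map_def)
  interpret V2: vectorspace K V2 using assms(2) by (simp add: linear_map_def)
  interpret W: vectorspace K W using assms(1) by (simp add: linear_map_def)
  interpret S: linear_map K V1 W S by fact
  interpret T: linear_map K V2 W T by fact
  obtain B where B: "finite B" "B \<subseteq> carrier V1" "V1.gen_set B"
    using assms(3) by (auto simp: V1.fin_dim_def)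
  obtain C where C: "finite C" "C \<subseteq> carrier V2" "V2.gen_set C"
    using assms(4) by (auto simp: V2.fin_dim_def)
  let ?G = "S ` B \<union> T ` C"
  have G: "?G \<subseteq> carrier W" using B C by auto
  have sub: "submodule K (W.span ?G) W"
    by (rule W.span_is_submodule[OF G])
  have mem: "?G \<subseteq> W.span ?G"
    by (rule W.in_own_span[OF G])
  have "w \<in> W.span ?G" if w: "w \<in> carrier W" for w
  proof -
    obtain x y where xy: "x \<in> carrier V1" "y \<in> carrier V2" "w = S x \<oplus>\<^bsub>W\<^esub> T y"
      using surj[OF w] by blast
    have "S x \<in> W.span ?G"
      by (rule S.image_span_subset[OF B(2) _ sub]) (use mem B xy in auto)
    moreover have "T y \<in> W.span ?G"
      by (rule T.image_span_subset[OF C(2) _ sub]) (use mem C xy in auto)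
    ultimately show ?thesis
      using W.span_add1[OF G] xy by simp
  qed
  then have "W.gen_set ?G"
    using W.span_is_subset2[OF G] by blast
  then show ?thesis
    unfolding W.fin_dim_def using B(1) C(1) G by (intro exI[of _ ?G]) simp
qed

text \<open>
  A linear functional is stated with values in the field \<open>K\<close> itself, without a module record for the
  one-dimensional space \<open>K\<close>.
\<close>

locale linear_functional = vectorspace K V
  for K :: "('a, 'k) ring_scheme" and V :: "('a, 'b, 'm) module_scheme" +
  fixes \<phi> :: "'b \<Rightarrow> 'a"
  assumes phi_closed [simp, intro]: "x \<in> carrier V \<Longrightarrow> \<phi> x \<in> carrier K"
    and phi_add: "\<lbrakk>x \<in> carrier V; y \<in> carrier V\<rbrakk> \<Longrightarrow> \<phi> (x \<oplus>\<^bsub>V\<^esub> y) = \<phi> x \<oplus>\<^bsub>K\<^esub> \<phi> y"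
    and phi_smult: "\<lbrakk>c \<in> carrier K; x \<in> carrier V\<rbrakk> \<Longrightarrow> \<phi> (c \<odot>\<^bsub>V\<^esub> x) = c \<otimes>\<^bsub>K\<^esub> \<phi> x"
begin

lemma phi_zero [simp]: "\<phi> \<zero>\<^bsub>V\<^esub> = \<zero>\<^bsub>K\<^esub>"
  using phi_smult[of "\<zero>\<^bsub>K\<^esub>" "\<zero>\<^bsub>V\<^esub>"] by simp

end

text \<open>The member of the dual basis that belongs to \<open>u\<close>.\<close>

lemma (in vectorspace) dual_basis_vector_exists:
  assumes B: "finite B" "basis B" and u: "u \<in> B"
  shows "\<exists>\<phi>. linear_functional K V \<phi> \<and> (\<forall>b \<in> B. \<phi> b = (if b = u then \<one>\<^bsub>K\<^esub> else \<zero>\<^bsub>K\<^esub>))"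
proof -
  have BV: "B \<subseteq> carrier V" using B(2) by (simp add: basis_def)
  have ex1: "\<exists>!a. a \<in> B \<rightarrow>\<^sub>E carrier K \<and> lincomb a B = v" if "v \<in> carrier V" for v
    using basis_criterion[OF B(1) BV] B(2) that by blast
  then obtain co where co: "\<And>v. v \<in> carrier V \<Longrightarrow> co v \<in> B \<rightarrow>\<^sub>E carrier K"
      "\<And>v. v \<in> carrier V \<Longrightarrow> lincomb (co v) B = v"
    by metis
  then have coP: "\<And>v. v \<in> carrier V \<Longrightarrow> co v \<in> B \<rightarrow> carrier K"
    by (auto simp: PiE_def)
  \<comment> \<open>Any linear combination that yields \<open>v\<close> can be used to compute the coordinate of \<open>v\<close> at \<open>u\<close>.\<close>
  have uniq: "co (lincomb a B) u = a u" if a: "a \<in> B \<rightarrow> carrier K" for a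
  proof -
    have "lincomb (restrict a B) B = lincomb a B"
      by (rule lincomb_cong[OF refl BV]) (use a in auto)
    moreover have "restrict a B \<in> B \<rightarrow>\<^sub>E carrier K" using a by auto
    moreover have cl: "lincomb a B \<in> carrier V" using BV a by auto
    ultimately have "co (lincomb a B) = restrict a B"
      using ex1[OF cl] co[OF cl] by blast
    then show ?thesis using u by simp
  qed
  have "co (x \<oplus>\<^bsub>V\<^esub> y) u = co x u \<oplus>\<^bsub>K\<^esub> co y u" if "x \<in> carrier V" "y \<in> carrier V" for x y
    using uniq[of "\<lambda>b. co x b \<oplus>\<^bsub>K\<^esub> co y b"] lincomb_sum[OF B(1) BV coP[OF that(1)] coP[OF that(2)]]
      coP[OF that(1)] coP[OF that(2)] co(2) that
    by (auto simp: Pi_iff)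
  moreover have "co (c \<odot>\<^bsub>V\<^esub> x) u = c \<otimes>\<^bsub>K\<^esub> co x u" if "c \<in> carrier K" "x \<in> carrier V" for c x
    using uniq[of "\<lambda>b. c \<otimes>\<^bsub>K\<^esub> co x b"] lincomb_smult[OF BV coP[OF that(2)] that(1)]
      coP[OF that(2)] co(2) that
    by (auto simp: Pi_iff)
  moreover have "co x u \<in> carrier K" if "x \<in> carrier V" for x
    using coP[OF that] u by auto
  ultimately have "linear_functional K V (\<lambda>v. co v u)"
    by unfold_locales auto
  moreover have "co b u = (if b = u then \<one>\<^bsub>K\<^esub> else \<zero>\<^bsub>K\<^esub>)" if b: "b \<in> B" for b
  proof -
    let ?\<delta> = "\<lambda>v. if v = b then \<one>\<^bsub>K\<^esub> else \<zero>\<^bsub>K\<^esub>"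
    have "lincomb ?\<delta> B = ?\<delta> b \<odot>\<^bsub>V\<^esub> b \<oplus>\<^bsub>V\<^esub> lincomb ?\<delta> (B - {b})"
      by (rule lincomb_del2[OF B(1) BV _ b]) auto
    also have "lincomb ?\<delta> (B - {b}) = \<zero>\<^bsub>V\<^esub>"
      by (rule lincomb_zero) (use BV in auto)
    finally have "lincomb ?\<delta> B = b" using b BV by auto
    then show ?thesis using uniq[of ?\<delta>] by auto
  qed
  ultimately show ?thesis by blast
qed

lemma (in vectorspace) dim_1_generator:
  assumes "fin_dim" "dim = 1"
  obtains a where "a \<in> carrier V" "a \<noteq> \<zero>\<^bsub>V\<^esub>"
    "\<And>v. v \<in> carrier V \<Longrightarrow> \<exists>c \<in> carrier K. v = c \<odot>\<^bsub>V\<^esub> a"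
proof -
  obtain B where B: "finite B" "basis B"
    using finite_basis_exists[OF assms(1)] by blast
  then have "card B = 1" using dim_basis assms(2) by simp
  then obtain a where Ba: "B = {a}" by (rule card_1_singletonE)
  then have a: "a \<in> carrier V" and gen: "span {a} = carrier V" and li: "lin_indpt {a}"
    using B(2) by (auto simp: basis_def)
  show ?thesis
  proof (rule that)
    show "a \<noteq> \<zero>\<^bsub>V\<^esub>" using vs_zero_lin_dep[OF _ li] a by auto
    fix v assume "v \<in> carrier V"
    then have "v \<in> span {a}" using gen by simp
    then obtain f where "f \<in> {a} \<rightarrow> carrier K" "lincomb f {a} = v"
      using finite_in_span[of "{a}" v] a by auto
    then show "\<exists>c \<in> carrier K. v = c \<odot>\<^bsub>V\<^esub> a"
      using a by (intro bexI[of _ "f a"]) (auto simp: lincomb_def)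
  qed (rule a)
qed


section \<open>Lie algebras whose central quotient is cyclic\<close>

lemma (in lie_algebra) center_bracket_right:
  assumes z: "z \<in> lie_center L" and x: "x \<in> carrier L"
  shows "\<lblot>x, z\<rblot> = \<zero>\<^bsub>L\<^esub>"
proof -
  have zL: "z \<in> carrier L" and zc: "\<And>y. y \<in> carrier L \<Longrightarrow> \<lblot>z, y\<rblot> = \<zero>\<^bsub>L\<^esub>"
    using z by (auto simp: lie_center_def)
  have "\<zero>\<^bsub>L\<^esub> = \<lblot>x \<oplus>\<^bsub>L\<^esub> z, x \<oplus>\<^bsub>L\<^esub> z\<rblot>"
    using x zL by (simp add: bracket_self)
  also have "\<dots> = \<lblot>x, x \<oplus>\<^bsub>L\<^esub> z\<rblot> \<oplus>\<^bsub>L\<^esub> \<lblot>z, x \<oplus>\<^bsub>L\<^esub> z\<rblot>"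
    by (rule bracket_add_left) (use x zL in auto)
  also have "\<dots> = \<lblot>x, x \<oplus>\<^bsub>L\<^esub> z\<rblot>"
    using x zL zc by simp
  also have "\<dots> = \<lblot>x, x\<rblot> \<oplus>\<^bsub>L\<^esub> \<lblot>x, z\<rblot>"
    by (rule bracket_add_right) (use x zL in auto)
  also have "\<dots> = \<lblot>x, z\<rblot>"
    using x zL by (simp add: bracket_self)
  finally show ?thesis by simp
qed

lemma (in lie_algebra) central_mod_cyclic_imp_abelian:
  assumes x: "x \<in> carrier L"
    and cyc: "\<And>e. e \<in> carrier L \<Longrightarrow> \<exists>c \<in> carrier K. \<exists>z \<in> lie_center L. e = z \<oplus>\<^bsub>L\<^esub> c \<odot>\<^bsub>L\<^esub> x"
  shows "lie_center L = carrier L"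
proof -
  have "\<lblot>e, e'\<rblot> = \<zero>\<^bsub>L\<^esub>" if e: "e \<in> carrier L" and e': "e' \<in> carrier L" for e e'
  proof -
    obtain c z where cz: "c \<in> carrier K" "z \<in> lie_center L" "e = z \<oplus>\<^bsub>L\<^esub> c \<odot>\<^bsub>L\<^esub> x"
      using cyc[OF e] by blast
    obtain c' z' where cz': "c' \<in> carrier K" "z' \<in> lie_center L" "e' = z' \<oplus>\<^bsub>L\<^esub> c' \<odot>\<^bsub>L\<^esub> x"
      using cyc[OF e'] by blast
    have zL: "z \<in> carrier L" "z' \<in> carrier L"
      and z: "\<And>y. y \<in> carrier L \<Longrightarrow> \<lblot>z, y\<rblot> = \<zero>\<^bsub>L\<^esub>"
      using cz(2) cz'(2) by (auto simp: lie_center_def)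
    note zc = z center_bracket_right[OF cz'(2)]
    show ?thesis
      using x zL zc cz(1) cz'(1) unfolding cz(3) cz'(3)
      by (simp add: bracket_add_left bracket_add_right bracket_smult_left bracket_smult_right
          bracket_self)
  qed
  then show ?thesis by (auto simp: lie_center_def)
qed

text \<open>
  The isomorphism \<open>f\<close> takes a generator \<open>a\<close> of \<open>A\<close> to a coset \<open>Z(E) + x\<close> that spans \<open>E/Z(E)\<close>.  So \<open>E\<close> is
  abelian, \<open>E\<close> is the only coset of \<open>Z(E) = E\<close>, and \<open>f\<close> identifies \<open>a\<close> with \<open>0\<close>.
\<close>

lemma not_capable_dim_1:
  assumes "fin_dim_lie_algebra K A" "vectorspace.dim K A = 1"
  shows "\<not> capable K A"
proof
  assume "capable K A"
  then obtain E :: "('a, nat \<Rightarrow> 'a) lie_alg" and f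
    where "fin_dim_lie_algebra K E" and f: "f \<in> lie_iso K A (lie_quotient E (lie_center E))"
    unfolding capable_def lie_isomorphic_def by blast
  interpret A: fin_dim_lie_algebra K A by fact
  interpret E: fin_dim_lie_algebra K E by fact
  let ?Z = "lie_center E"
  obtain a where a: "a \<in> carrier A" "a \<noteq> \<zero>\<^bsub>A\<^esub>"
      and gen: "\<And>v. v \<in> carrier A \<Longrightarrow> \<exists>c \<in> carrier K. v = c \<odot>\<^bsub>A\<^esub> a"
    using A.dim_1_generator[OF A.fin_dim_L assms(2)] by metis
  have bij: "bij_betw f (carrier A) (a_rcosets\<^bsub>E\<^esub> ?Z)"
    and smult: "\<And>c v. \<lbrakk>c \<in> carrier K; v \<in> carrier A\<rbrakk> \<Longrightarrow>
        f (c \<odot>\<^bsub>A\<^esub> v) = (\<Union>y\<in>f v. ?Z +>\<^bsub>E\<^esub> c \<odot>\<^bsub>E\<^esub> y)"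
    using f by (auto simp: lie_iso_def module_hom_def lie_quotient_def)
  have Z0: "\<zero>\<^bsub>E\<^esub> \<in> ?Z"
    using E.bracket_smult_left[of "\<zero>\<^bsub>K\<^esub>" "\<zero>\<^bsub>E\<^esub>"] by (simp add: lie_center_def)
  have ZE: "?Z \<subseteq> carrier E" by (auto simp: lie_center_def)
  have "f a \<in> a_rcosets\<^bsub>E\<^esub> ?Z" using bij a(1) by (auto simp: bij_betw_def)
  then obtain x where x: "x \<in> carrier E" "f a = ?Z +>\<^bsub>E\<^esub> x"
    by (auto simp: A_RCOSETS_def')
  have "\<exists>c \<in> carrier K. \<exists>z \<in> ?Z. e = z \<oplus>\<^bsub>E\<^esub> c \<odot>\<^bsub>E\<^esub> x" if e: "e \<in> carrier E" for e
  proof -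
    have "?Z +>\<^bsub>E\<^esub> e \<in> a_rcosets\<^bsub>E\<^esub> ?Z" using e by (auto simp: A_RCOSETS_def')
    then obtain v where "v \<in> carrier A" "f v = ?Z +>\<^bsub>E\<^esub> e"
      using bij by (metis bij_betw_imp_surj_on imageE)
    then obtain c where c: "c \<in> carrier K" "(\<Union>y\<in>f a. ?Z +>\<^bsub>E\<^esub> c \<odot>\<^bsub>E\<^esub> y) = ?Z +>\<^bsub>E\<^esub> e"
      using gen smult a(1) by metis
    \<comment> \<open>Scalar multiplication in the quotient is a union over all representatives \<open>z' + x\<close> of \<open>f a\<close>.\<close>
    have "e \<in> ?Z +>\<^bsub>E\<^esub> e" using Z0 e by (force simp: a_r_coset_def')
    then have "e \<in> (\<Union>y\<in>f a. ?Z +>\<^bsub>E\<^esub> c \<odot>\<^bsub>E\<^esub> y)" by (simp only: c(2))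
    then obtain z z' where z: "z \<in> ?Z" "z' \<in> ?Z" "e = z \<oplus>\<^bsub>E\<^esub> c \<odot>\<^bsub>E\<^esub> (z' \<oplus>\<^bsub>E\<^esub> x)"
      using x(2) by (auto simp: a_r_coset_def')
    have zE: "z \<in> carrier E" "z' \<in> carrier E" using z ZE by auto
    have "e = (z \<oplus>\<^bsub>E\<^esub> c \<odot>\<^bsub>E\<^esub> z') \<oplus>\<^bsub>E\<^esub> c \<odot>\<^bsub>E\<^esub> x"
      using zE x(1) c(1) z(3) by (simp add: E.smult_r_distr E.M.a_assoc)
    moreover have "z \<oplus>\<^bsub>E\<^esub> c \<odot>\<^bsub>E\<^esub> z' \<in> ?Z"
      using z zE c(1) by (auto simp: lie_center_def E.bracket_add_left E.bracket_smult_left)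
    ultimately show ?thesis using c(1) by blast
  qed
  then have Z: "?Z = carrier E"
    by (rule E.central_mod_cyclic_imp_abelian[OF x(1)])
  have "f v = carrier E" if "v \<in> carrier A" for v
  proof -
    have "f v \<in> a_rcosets\<^bsub>E\<^esub> ?Z" using bij that by (auto simp: bij_betw_def)
    then obtain y where y: "y \<in> carrier E" "f v = carrier E +>\<^bsub>E\<^esub> y"
      by (auto simp: A_RCOSETS_def' Z)
    have "e \<in> carrier E +>\<^bsub>E\<^esub> y" if "e \<in> carrier E" for e
      using that y(1) by (auto simp: a_r_coset_def' E.M.a_assoc E.M.l_neg intro!: bexI[of _ "e \<oplus>\<^bsub>E\<^esub> \<ominus>\<^bsub>E\<^esub> y"])
    then show ?thesis using y by (auto simp: a_r_coset_def')
  qed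
  then have "f a = f \<zero>\<^bsub>A\<^esub>" using a(1) by simp
  then show False
    using bij a by (auto simp: bij_betw_def inj_on_eq_iff)
qed


section \<open>A central extension defined by a linear functional\<close>

text \<open>
  The space \<open>V \<times> V\<close> with the bracket \<open>[(a, c), (b, d)] = (0, \<phi>(a) b - \<phi>(b) a)\<close>, a central extension
  by \<open>0 \<times> V\<close> of the abelian Lie algebra on \<open>V\<close>.
\<close>

definition functional_extension ::
    "('a, 'b, 'm) module_scheme \<Rightarrow> ('b \<Rightarrow> 'a) \<Rightarrow> ('a, 'b \<times> 'b) lie_alg"
  where "functional_extension V \<phi> =
    \<lparr>carrier = carrier V \<times> carrier V, mult = undefined, one = undefined,
     zero = (\<zero>\<^bsub>V\<^esub>, \<zero>\<^bsub>V\<^esub>),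
     add = (\<lambda>x y. (fst x \<oplus>\<^bsub>V\<^esub> fst y, snd x \<oplus>\<^bsub>V\<^esub> snd y)),
     smult = (\<lambda>c x. (c \<odot>\<^bsub>V\<^esub> fst x, c \<odot>\<^bsub>V\<^esub> snd x)),
     bracket = (\<lambda>x y. (\<zero>\<^bsub>V\<^esub>, \<phi> (fst x) \<odot>\<^bsub>V\<^esub> fst y \<ominus>\<^bsub>V\<^esub> \<phi> (fst y) \<odot>\<^bsub>V\<^esub> fst x))\<rparr>"

context linear_functional
begin

abbreviation E :: "('a, 'b \<times> 'b) lie_alg"
  where "E \<equiv> functional_extension V \<phi>"

lemma functional_extension_simps [simp]:
  "carrier E = carrier V \<times> carrier V"
  "\<zero>\<^bsub>E\<^esub> = (\<zero>\<^bsub>V\<^esub>, \<zero>\<^bsub>V\<^esub>)"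
  "(a, c) \<oplus>\<^bsub>E\<^esub> (b, d) = (a \<oplus>\<^bsub>V\<^esub> b, c \<oplus>\<^bsub>V\<^esub> d)"
  "k \<odot>\<^bsub>E\<^esub> (a, c) = (k \<odot>\<^bsub>V\<^esub> a, k \<odot>\<^bsub>V\<^esub> c)"
  "\<lblot>(a, c), (b, d)\<rblot>\<^bsub>E\<^esub> = (\<zero>\<^bsub>V\<^esub>, \<phi> a \<odot>\<^bsub>V\<^esub> b \<ominus>\<^bsub>V\<^esub> \<phi> b \<odot>\<^bsub>V\<^esub> a)"
  by (simp_all add: functional_extension_def)

lemma functional_extension_vectorspace: "vectorspace K E"
proof (rule vs_criteria)
  show "field K" ..
  show "\<forall>v\<in>carrier E. \<exists>neg_v\<in>carrier E. v \<oplus>\<^bsub>E\<^esub> neg_v = \<zero>\<^bsub>E\<^esub>"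
  proof
    fix v assume "v \<in> carrier E"
    then show "\<exists>neg_v\<in>carrier E. v \<oplus>\<^bsub>E\<^esub> neg_v = \<zero>\<^bsub>E\<^esub>"
      by (intro bexI[of _ "(\<ominus>\<^bsub>V\<^esub> fst v, \<ominus>\<^bsub>V\<^esub> snd v)"]) (auto simp: M.r_neg)
  qed
qed (auto simp: M.a_ac smult_assoc1 smult_l_distr smult_r_distr)

lemma functional_extension_lie_algebra: "lie_algebra K E"
proof -
  interpret E: vectorspace K E by (rule functional_extension_vectorspace)
  have add_left: "\<phi> (a \<oplus>\<^bsub>V\<^esub> b) \<odot>\<^bsub>V\<^esub> c \<ominus>\<^bsub>V\<^esub> \<phi> c \<odot>\<^bsub>V\<^esub> (a \<oplus>\<^bsub>V\<^esub> b) =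
      (\<phi> a \<odot>\<^bsub>V\<^esub> c \<ominus>\<^bsub>V\<^esub> \<phi> c \<odot>\<^bsub>V\<^esub> a) \<oplus>\<^bsub>V\<^esub> (\<phi> b \<odot>\<^bsub>V\<^esub> c \<ominus>\<^bsub>V\<^esub> \<phi> c \<odot>\<^bsub>V\<^esub> b)"
    if "a \<in> carrier V" "b \<in> carrier V" "c \<in> carrier V" for a b c
    using that by (simp add: phi_add smult_l_distr smult_r_distr a_minus_def M.minus_add M.a_ac)
  have add_right: "\<phi> a \<odot>\<^bsub>V\<^esub> (b \<oplus>\<^bsub>V\<^esub> c) \<ominus>\<^bsub>V\<^esub> \<phi> (b \<oplus>\<^bsub>V\<^esub> c) \<odot>\<^bsub>V\<^esub> a =
      (\<phi> a \<odot>\<^bsub>V\<^esub> b \<ominus>\<^bsub>V\<^esub> \<phi> b \<odot>\<^bsub>V\<^esub> a) \<oplus>\<^bsub>V\<^esub> (\<phi> a \<odot>\<^bsub>V\<^esub> c \<ominus>\<^bsub>V\<^esub> \<phi> c \<odot>\<^bsub>V\<^esub> a)"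
    if "a \<in> carrier V" "b \<in> carrier V" "c \<in> carrier V" for a b c
    using that by (simp add: phi_add smult_l_distr smult_r_distr a_minus_def M.minus_add M.a_ac)
  have smult_left: "\<phi> (k \<odot>\<^bsub>V\<^esub> a) \<odot>\<^bsub>V\<^esub> b \<ominus>\<^bsub>V\<^esub> \<phi> b \<odot>\<^bsub>V\<^esub> (k \<odot>\<^bsub>V\<^esub> a) =
      k \<odot>\<^bsub>V\<^esub> (\<phi> a \<odot>\<^bsub>V\<^esub> b \<ominus>\<^bsub>V\<^esub> \<phi> b \<odot>\<^bsub>V\<^esub> a)"
    if "k \<in> carrier K" "a \<in> carrier V" "b \<in> carrier V" for k a b
    using that by (simp add: phi_smult smult_r_distr smult_r_minus a_minus_def R.m_comm
        flip: smult_assoc1)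
  have smult_right: "\<phi> a \<odot>\<^bsub>V\<^esub> (k \<odot>\<^bsub>V\<^esub> b) \<ominus>\<^bsub>V\<^esub> \<phi> (k \<odot>\<^bsub>V\<^esub> b) \<odot>\<^bsub>V\<^esub> a =
      k \<odot>\<^bsub>V\<^esub> (\<phi> a \<odot>\<^bsub>V\<^esub> b \<ominus>\<^bsub>V\<^esub> \<phi> b \<odot>\<^bsub>V\<^esub> a)"
    if "k \<in> carrier K" "a \<in> carrier V" "b \<in> carrier V" for k a b
    using that by (simp add: phi_smult smult_r_distr smult_r_minus a_minus_def R.m_comm
        flip: smult_assoc1)
  \<comment> \<open>Each of the three terms of the Jacobi identity vanishes.\<close>
  have jacobi: "\<lblot>x, \<lblot>y, z\<rblot>\<^bsub>E\<^esub>\<rblot>\<^bsub>E\<^esub> = \<zero>\<^bsub>E\<^esub>"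
    if "x \<in> carrier E" "y \<in> carrier E" "z \<in> carrier E" for x y z
    using that by (auto simp: a_minus_def)
  show ?thesis
  proof unfold_locales
    fix x y z assume "x \<in> carrier E" "y \<in> carrier E" "z \<in> carrier E"
    then show "\<lblot>x \<oplus>\<^bsub>E\<^esub> y, z\<rblot>\<^bsub>E\<^esub> = \<lblot>x, z\<rblot>\<^bsub>E\<^esub> \<oplus>\<^bsub>E\<^esub> \<lblot>y, z\<rblot>\<^bsub>E\<^esub>"
      and "\<lblot>x, y \<oplus>\<^bsub>E\<^esub> z\<rblot>\<^bsub>E\<^esub> = \<lblot>x, y\<rblot>\<^bsub>E\<^esub> \<oplus>\<^bsub>E\<^esub> \<lblot>x, z\<rblot>\<^bsub>E\<^esub>"
      by (auto simp: add_left add_right)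
  next
    fix k x y assume "k \<in> carrier K" "x \<in> carrier E" "y \<in> carrier E"
    then show "\<lblot>k \<odot>\<^bsub>E\<^esub> x, y\<rblot>\<^bsub>E\<^esub> = k \<odot>\<^bsub>E\<^esub> \<lblot>x, y\<rblot>\<^bsub>E\<^esub>"
      and "\<lblot>x, k \<odot>\<^bsub>E\<^esub> y\<rblot>\<^bsub>E\<^esub> = k \<odot>\<^bsub>E\<^esub> \<lblot>x, y\<rblot>\<^bsub>E\<^esub>"
      by (auto simp: smult_left smult_right)
  next
    fix x y assume "x \<in> carrier E" "y \<in> carrier E"
    then show "\<lblot>x, y\<rblot>\<^bsub>E\<^esub> \<in> carrier E" by auto
  next
    fix x assume "x \<in> carrier E"
    then show "\<lblot>x, x\<rblot>\<^bsub>E\<^esub> = \<zero>\<^bsub>E\<^esub>" by (auto simp: M.r_neg a_minus_def)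
  next
    fix x y z assume "x \<in> carrier E" "y \<in> carrier E" "z \<in> carrier E"
    then show "\<lblot>x, \<lblot>y, z\<rblot>\<^bsub>E\<^esub>\<rblot>\<^bsub>E\<^esub> \<oplus>\<^bsub>E\<^esub> \<lblot>y, \<lblot>z, x\<rblot>\<^bsub>E\<^esub>\<rblot>\<^bsub>E\<^esub> \<oplus>\<^bsub>E\<^esub> \<lblot>z, \<lblot>x, y\<rblot>\<^bsub>E\<^esub>\<rblot>\<^bsub>E\<^esub> = \<zero>\<^bsub>E\<^esub>"
      by (simp only: jacobi) simp
  qed
qed

lemma functional_extension_fin_dim:
  assumes "fin_dim"
  shows "fin_dim_lie_algebra K E"
proof -
  interpret E: lie_algebra K E by (rule functional_extension_lie_algebra)
  have "linear_map K V E (\<lambda>v. (v, \<zero>\<^bsub>V\<^esub>))" "linear_map K V E (\<lambda>v. (\<zero>\<^bsub>V\<^esub>, v))"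
    by (unfold_locales; auto simp: module_hom_def)+
  then have "E.fin_dim"
    by (rule fin_dim_sum_of_images[OF _ _ assms assms]) auto
  then show ?thesis by unfold_locales
qed

lemma functional_extension_center:
  assumes u: "u \<in> carrier V" "\<phi> u = \<one>\<^bsub>K\<^esub>"
    and w: "w \<in> carrier V" "w \<noteq> \<zero>\<^bsub>V\<^esub>" "\<phi> w = \<zero>\<^bsub>K\<^esub>"
  shows "lie_center E = {\<zero>\<^bsub>V\<^esub>} \<times> carrier V"
proof -
  have "a = \<zero>\<^bsub>V\<^esub>" if a: "a \<in> carrier V"
    and rad: "\<And>b. b \<in> carrier V \<Longrightarrow> \<phi> a \<odot>\<^bsub>V\<^esub> b \<ominus>\<^bsub>V\<^esub> \<phi> b \<odot>\<^bsub>V\<^esub> a = \<zero>\<^bsub>V\<^esub>" for a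
  proof -
    \<comment> \<open>Applied to \<open>b = w\<close> to get \<open>\<phi> a = 0\<close>, and then to \<open>b = u\<close>.\<close>
    have eq: "\<phi> a \<odot>\<^bsub>V\<^esub> b = \<phi> b \<odot>\<^bsub>V\<^esub> a" if "b \<in> carrier V" for b
      using rad[OF that] that a by simp
    have "\<phi> a \<odot>\<^bsub>V\<^esub> w = \<zero>\<^bsub>V\<^esub>" using eq[OF w(1)] w a by simp
    then have "\<phi> a = \<zero>\<^bsub>K\<^esub>"
      using mult_inverse[of "\<phi> a" w "\<zero>\<^bsub>V\<^esub>"] a w by force
    then show ?thesis using eq[OF u(1)] u a by simp
  qed
  then have "x \<in> {\<zero>\<^bsub>V\<^esub>} \<times> carrier V" if "x \<in> lie_center E" for x
    using that by (fastforce simp: lie_center_def)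
  moreover have "x \<in> lie_center E" if "x \<in> {\<zero>\<^bsub>V\<^esub>} \<times> carrier V" for x
    using that by (auto simp: lie_center_def a_minus_def)
  ultimately show ?thesis by blast
qed

end

text \<open>
  The coset of \<open>(a, c)\<close> modulo \<open>0 \<times> A\<close> is \<open>{a} \<times> A\<close>, whatever \<open>c\<close> is, so \<open>a \<mapsto> {a} \<times> A\<close> is a bijection
  onto the quotient.  Brackets in the extension have first component \<open>0\<close>, as those of \<open>A\<close> do.
\<close>

lemma functional_extension_central_quotient:
  fixes A :: "('a, 'b, 'm) lie_alg_scheme"
  assumes "linear_functional K A \<phi>" and ab: "abelian_lie A"
    and Z: "lie_center (functional_extension A \<phi>) = {\<zero>\<^bsub>A\<^esub>} \<times> carrier A"
  shows "(\<lambda>a. {a} \<times> carrier A) \<in> lie_iso K A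
    (lie_quotient (functional_extension A \<phi>) (lie_center (functional_extension A \<phi>)))"
proof -
  interpret linear_functional K A \<phi> by fact
  let ?Z = "{\<zero>\<^bsub>A\<^esub>} \<times> carrier A"
  have shift: "(\<lambda>d. d \<oplus>\<^bsub>A\<^esub> c) ` carrier A = carrier A" if c: "c \<in> carrier A" for c
  proof
    show "carrier A \<subseteq> (\<lambda>d. d \<oplus>\<^bsub>A\<^esub> c) ` carrier A"
    proof
      fix d assume "d \<in> carrier A"
      then show "d \<in> (\<lambda>d. d \<oplus>\<^bsub>A\<^esub> c) ` carrier A"
        using c by (intro image_eqI[of _ _ "d \<oplus>\<^bsub>A\<^esub> \<ominus>\<^bsub>A\<^esub> c"]) (auto simp: M.a_assoc M.l_neg)
    qed
  qed (use c in auto)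
  have coset: "?Z +>\<^bsub>E\<^esub> (a, c) = {a} \<times> carrier A" if "a \<in> carrier A" "c \<in> carrier A" for a c
  proof -
    have "?Z +>\<^bsub>E\<^esub> (a, c) = {a} \<times> (\<lambda>d. d \<oplus>\<^bsub>A\<^esub> c) ` carrier A"
      using that by (force simp: a_r_coset_def')
    then show ?thesis using shift[OF that(2)] by simp
  qed
  have carr: "a_rcosets\<^bsub>E\<^esub> ?Z = (\<lambda>a. {a} \<times> carrier A) ` carrier A"
  proof (intro equalityI subsetI)
    fix X assume "X \<in> a_rcosets\<^bsub>E\<^esub> ?Z"
    then obtain a c where "a \<in> carrier A" "c \<in> carrier A" "X = ?Z +>\<^bsub>E\<^esub> (a, c)"
      unfolding A_RCOSETS_def' by auto
    then show "X \<in> (\<lambda>a. {a} \<times> carrier A) ` carrier A" using coset by blast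
  next
    fix X assume "X \<in> (\<lambda>a. {a} \<times> carrier A) ` carrier A"
    then obtain a where a: "a \<in> carrier A" "X = ?Z +>\<^bsub>E\<^esub> (a, \<zero>\<^bsub>A\<^esub>)"
      using coset[OF _ M.zero_closed] by blast
    then show "X \<in> a_rcosets\<^bsub>E\<^esub> ?Z" unfolding A_RCOSETS_def' by auto
  qed
  have "inj_on (\<lambda>a. {a} \<times> carrier A) (carrier A)"
  proof (rule inj_onI)
    fix a b assume "{a} \<times> carrier A = {b} \<times> carrier A"
    then have "(a, \<zero>\<^bsub>A\<^esub>) \<in> {b} \<times> carrier A" using M.zero_closed by blast
    then show "a = b" by blast
  qed
  then have bij: "bij_betw (\<lambda>a. {a} \<times> carrier A) (carrier A) (a_rcosets\<^bsub>E\<^esub> ?Z)"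
    unfolding bij_betw_def carr by blast
  have add: "{a} \<times> carrier A <+>\<^bsub>E\<^esub> {b} \<times> carrier A = {a \<oplus>\<^bsub>A\<^esub> b} \<times> carrier A"
    if "a \<in> carrier A" "b \<in> carrier A" for a b
  proof (intro equalityI subsetI)
    fix x assume "x \<in> {a} \<times> carrier A <+>\<^bsub>E\<^esub> {b} \<times> carrier A"
    then show "x \<in> {a \<oplus>\<^bsub>A\<^esub> b} \<times> carrier A" by (auto simp: set_add_def')
  next
    fix x assume "x \<in> {a \<oplus>\<^bsub>A\<^esub> b} \<times> carrier A"
    then obtain d where d: "d \<in> carrier A" "x = (a, \<zero>\<^bsub>A\<^esub>) \<oplus>\<^bsub>E\<^esub> (b, d)" by auto
    then show "x \<in> {a} \<times> carrier A <+>\<^bsub>E\<^esub> {b} \<times> carrier A"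
      using M.zero_closed unfolding set_add_def' by blast
  qed
  have smult: "(\<Union>x\<in>{a} \<times> carrier A. ?Z +>\<^bsub>E\<^esub> k \<odot>\<^bsub>E\<^esub> x) = {k \<odot>\<^bsub>A\<^esub> a} \<times> carrier A"
    if "k \<in> carrier K" "a \<in> carrier A" for k a
  proof (rule UN_constant_eq)
    show "(a, \<zero>\<^bsub>A\<^esub>) \<in> {a} \<times> carrier A" by simp
    show "\<forall>x\<in>{a} \<times> carrier A. ?Z +>\<^bsub>E\<^esub> k \<odot>\<^bsub>E\<^esub> x = {k \<odot>\<^bsub>A\<^esub> a} \<times> carrier A"
      using that by (auto simp only: mem_Sigma_iff functional_extension_simps coset smult_closed
          singleton_iff)
  qed
  have brack: "(\<Union>x\<in>{a} \<times> carrier A. \<Union>y\<in>{b} \<times> carrier A. ?Z +>\<^bsub>E\<^esub> \<lblot>x, y\<rblot>\<^bsub>E\<^esub>) =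
      {\<lblot>a, b\<rblot>\<^bsub>A\<^esub>} \<times> carrier A"
    if ab': "a \<in> carrier A" "b \<in> carrier A" for a b
  proof -
    have "?Z +>\<^bsub>E\<^esub> \<lblot>x, y\<rblot>\<^bsub>E\<^esub> = {\<lblot>a, b\<rblot>\<^bsub>A\<^esub>} \<times> carrier A"
      if xy: "x \<in> {a} \<times> carrier A" "y \<in> {b} \<times> carrier A" for x y
    proof -
      obtain c d where "x = (a, c)" "y = (b, d)" using xy by blast
      moreover have "\<lblot>a, b\<rblot>\<^bsub>A\<^esub> = \<zero>\<^bsub>A\<^esub>" using ab ab' by (simp add: abelian_lie_def)
      ultimately show ?thesis using ab' by (simp add: coset)
    qed
    then have "(\<Union>y\<in>{b} \<times> carrier A. ?Z +>\<^bsub>E\<^esub> \<lblot>x, y\<rblot>\<^bsub>E\<^esub>) = {\<lblot>a, b\<rblot>\<^bsub>A\<^esub>} \<times> carrier A"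
      if "x \<in> {a} \<times> carrier A" for x
      using that M.zero_closed by (intro UN_constant_eq[of "(b, \<zero>\<^bsub>A\<^esub>)"]) blast+
    then show ?thesis
      using M.zero_closed by (intro UN_constant_eq[of "(a, \<zero>\<^bsub>A\<^esub>)"]) blast+
  qed
  show ?thesis
    unfolding Z lie_iso_def module_hom_def lie_quotient_def
    using bij by (auto simp: add smult brack carr)
qed

section \<open>Capability of abelian Lie algebras\<close>

lemma capable_dim_ge_2:
  assumes "fin_dim_lie_algebra K A" "abelian_lie A" "vectorspace.dim K A \<ge> 2"
  shows "capable K A"
proof -
  interpret A: fin_dim_lie_algebra K A by fact
  obtain B where B: "finite B" "A.basis B"
    using A.finite_basis_exists[OF A.fin_dim_L] by blast
  then have BA: "B \<subseteq> carrier A" and li: "A.lin_indpt B" by (auto simp: A.basis_def)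
  have "card B \<ge> 2" using A.dim_basis[OF B] assms(3) by simp
  then obtain u w where uw: "u \<in> B" "w \<in> B" "u \<noteq> w"
    by (metis card_2_iff' obtain_subset_with_card_n subsetD)
  obtain \<phi> where \<phi>: "linear_functional K A \<phi>"
      and val: "\<And>b. b \<in> B \<Longrightarrow> \<phi> b = (if b = u then \<one>\<^bsub>K\<^esub> else \<zero>\<^bsub>K\<^esub>)"
    using A.dual_basis_vector_exists[OF B uw(1)] by blast
  interpret linear_functional K A \<phi> by (rule \<phi>)
  have "w \<noteq> \<zero>\<^bsub>A\<^esub>" using A.vs_zero_lin_dep[OF BA li] uw(2) by auto
  then have "lie_center E = {\<zero>\<^bsub>A\<^esub>} \<times> carrier A"
    by (intro functional_extension_center[of u w]) (use uw BA val in auto)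
  then have "lie_isomorphic K A (lie_quotient E (lie_center E))"
    using functional_extension_central_quotient[OF \<phi> assms(2)] by (auto simp: lie_isomorphic_def)
  then show ?thesis
    by (rule capableI[OF functional_extension_fin_dim[OF A.fin_dim_L]])
qed

theorem theorem3p3:
  fixes K :: "('a, 'k) ring_scheme" and A :: "('a, 'b, 'm) lie_alg_scheme" and n :: nat
  assumes "fin_dim_lie_algebra K A"
    and "abelian_lie A"
    and "vectorspace.dim K A = n"
    and "n \<ge> 1"
  shows "capable K A \<longleftrightarrow> n \<ge> 2"
proof
  assume "capable K A"
  then have "n \<noteq> 1" using not_capable_dim_1[OF assms(1)] assms(3) by auto
  then show "n \<ge> 2" using assms(4) by simp
next
  assume "n \<ge> 2"
  then show "capable K A" using capable_dim_ge_2[OF assms(1,2)] assms(3) by simp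
qed

end
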